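(* The Jacobson radical of the degenerate affine periplectic Brauer algebra $\mathcal{V}_2$ is the two-sided ideal generated by $e_1$: $\mathrm{J}(\mathcal{V}_2)=(e_1)$.
   Context: The algebra $\mathcal{V}_2$ is the unital associative $\mathbb{C}$-algebra with generators $s_1,e_1,y_1,y_2$ and relations: $s_1^2=1$; $e_1^2=0$; $e_1s_1=e_1$; $s_1e_1=-e_1$; $y_1y_2=y_2y_1$; $s_1y_1-y_2s_1=-e_1-1$; $y_1s_1-s_1y_2=e_1-1$; $e_1(y_1-y_2)=-e_1$; $(y_1-y_2)e_1=e_1$. The Jacobson radical $\mathrm{J}(A)$ of an associative algebra $A$ is the intersection of all maximal left ideals of $A$. *)

theory Defs
  imports
    Complex_Main
    "HOL-Library.Poly_Mapping"
    "HOL-Algebra.QuotRing"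
    "HOL-Algebra.Algebraic_Closure_Type"
begin

section \<open>The Jacobson radical of a (noncommutative) ring\<close>

locale left_ideal = additive_subgroup I R + ring R for I and R (structure) +
  assumes l_closed: "\<lbrakk>a \<in> I; x \<in> carrier R\<rbrakk> \<Longrightarrow> x \<otimes> a \<in> I"

locale maximal_left_ideal = left_ideal +
  assumes I_notcarr: "carrier R \<noteq> I"
    and I_maximal: "\<lbrakk>left_ideal J R; I \<subseteq> J; J \<subseteq> carrier R\<rbrakk> \<Longrightarrow> J = I \<or> J = carrier R"

text \<open>
  Intersecting with the carrier only matters when there are no maximal left ideals at all
  (the zero ring): there the empty intersection has to be the whole ring, not \<^term>\<open>UNIV\<close>.
\<close>

definition jacobson_radical :: "('a, 'b) ring_scheme \<Rightarrow> 'a set" where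
  "jacobson_radical R = carrier R \<inter> \<Inter> {M. maximal_left_ideal M R}"


section \<open>Free unital associative complex algebras\<close>

text \<open>
  Finitely supported functions on a monoid carry the convolution product, but that product is
  set up for monoids written additively.  We therefore write the free monoid (words under
  concatenation, neutral element the empty word) additively, although it is not commutative.
  The finitely supported functions from words to the complex numbers then form the free
  unital associative algebra, a scalar c being the constant \<^term>\<open>Poly_Mapping.single 0 c\<close>.
\<close>

datatype 'x word = Word (letters: "'x list")

instantiation word :: (type) monoid_add
begin

definition zero_word :: "'x word" where
  "zero_word = Word []"

definition plus_word :: "'x word \<Rightarrow> 'x word \<Rightarrow> 'x word" where
  "plus_word u v = Word (letters u @ letters v)"

instance
  by standard (simp_all add: zero_word_def plus_word_def)

end

type_synonym 'x free_alg = "'x word \<Rightarrow>\<^sub>0 complex"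

definition gen :: "'x \<Rightarrow> 'x free_alg" where
  "gen x = Poly_Mapping.single (Word [x]) 1"


section \<open>The algebra $V_2$\<close>

datatype v2_gen = S1 | E1 | Y1 | Y2

text \<open>A relation $l = r$ is recorded as the element $l - r$ of the free algebra.\<close>

definition v2_relators :: "v2_gen free_alg set" where
  "v2_relators =
    (let s1 = gen S1; e1 = gen E1; y1 = gen Y1; y2 = gen Y2 in
     {s1 * s1 - 1,
      e1 * e1 - 0,
      e1 * s1 - e1,
      s1 * e1 - (- e1),
      y1 * y2 - y2 * y1,
      (s1 * y1 - y2 * s1) - (- e1 - 1),
      (y1 * s1 - s1 * y2) - (e1 - 1),
      e1 * (y1 - y2) - (- e1),
      (y1 - y2) * e1 - e1})"

definition v2_free :: "v2_gen free_alg ring" where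
  "v2_free = ring_of_type_algebra"

text \<open>
  As the free algebra is unital and contains the scalars, its two-sided ring ideals
  are exactly its two-sided algebra ideals.
\<close>

definition v2_ideal :: "v2_gen free_alg set" where
  "v2_ideal = Idl\<^bsub>v2_free\<^esub> v2_relators"

definition V2 :: "v2_gen free_alg set ring" where
  "V2 = v2_free Quot v2_ideal"

definition v2_class :: "v2_gen free_alg \<Rightarrow> v2_gen free_alg set" where
  "v2_class p = v2_ideal +>\<^bsub>v2_free\<^esub> p"

definition v2_e1 :: "v2_gen free_alg set" where
  "v2_e1 = v2_class (gen E1)"

lemma carrier_v2_free [simp]: "carrier v2_free = UNIV"
  by (simp add: v2_free_def ring_of_type_algebra_def)

lemma ring_v2_free: "ring v2_free"
proof -
  have "\<exists>q. p + q = 0" for p :: "v2_gen free_alg"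
    using add.right_inverse by blast
  then show ?thesis
    unfolding v2_free_def ring_of_type_algebra_def
    using add.right_inverse by unfold_locales (auto simp: algebra_simps Units_def)
qed

lemma ideal_v2_ideal: "ideal v2_ideal v2_free"
  unfolding v2_ideal_def by (rule ring.genideal_ideal[OF ring_v2_free]) simp

lemma ring_V2: "ring V2"
  unfolding V2_def by (rule ideal.quotient_is_ring[OF ideal_v2_ideal])

lemma v2_class_hom: "v2_class \<in> ring_hom v2_free V2"
  using ideal.rcos_ring_hom[OF ideal_v2_ideal] unfolding V2_def v2_class_def[abs_def] .

lemma v2_class_in_carrier [simp]: "v2_class p \<in> carrier V2"
  using v2_class_hom by (auto dest: ring_hom_closed[where x = p])

end

theory Submission
  imports Defs "HOL-Library.Product_Plus"
begin

text \<open>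
  From \<open>s\<^sub>1 e\<^sub>1 = - e\<^sub>1\<close> one gets \<open>e\<^sub>1 V\<^sub>2 e\<^sub>1 = 0\<close>, so \<open>(e\<^sub>1)\<close> squares to zero and
  lies in the radical.  Conversely, \<open>V\<^sub>2 / (e\<^sub>1)\<close> is the degenerate affine Hecke algebra of
  rank two, each of whose elements has the form \<open>f(y\<^sub>1, y\<^sub>2) + s\<^sub>1 g(y\<^sub>1, y\<^sub>2)\<close>.
  For \<open>a - b \<notin> {0, 1, -1}\<close> it has an irreducible two-dimensional module with a vector
  \<open>v\<close> such that \<open>y\<^sub>1 v = a v\<close>, \<open>y\<^sub>2 v = b v\<close>, and \<open>v\<close>, \<open>s\<^sub>1 v\<close> are linearly independent.
  The annihilator of \<open>v\<close> is a maximal left ideal, so an element of the radical satisfies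
  \<open>f(a, b) = g(a, b) = 0\<close> for all such pairs, whence \<open>f = g = 0\<close>.
\<close>

section \<open>Square-zero ideals and the Jacobson radical\<close>

text \<open>If \<open>N\<close> were not inside \<open>M\<close>, maximality would give
  \<open>1 = m + n\<close> with \<open>m\<close> in \<open>M\<close> and \<open>n\<close> in
  \<open>N\<close>. Multiplying by \<open>n\<close> on the left yields \<open>n = n m\<close>, which
  lies in \<open>M\<close>, and then so does 1.\<close>

lemma (in ring) square_zero_ideal_subset_jacobson_radical:
  assumes "ideal N R" and sq: "\<And>x y. x \<in> N \<Longrightarrow> y \<in> N \<Longrightarrow> x \<otimes> y = \<zero>"
  shows "N \<subseteq> jacobson_radical R"
proof -
  interpret N: ideal N R by fact
  have "N \<subseteq> M" if M: "maximal_left_ideal M R" for M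
  proof (rule ccontr)
    assume "\<not> N \<subseteq> M"
    interpret M: maximal_left_ideal M R by fact
    let ?J = "M <+>\<^bsub>R\<^esub> N"
    have mem: "x \<in> ?J \<longleftrightarrow> (\<exists>m\<in>M. \<exists>n\<in>N. x = m \<oplus> n)" for x
      by (auto simp: set_add_def')
    have memI: "m \<oplus> n \<in> ?J" if "m \<in> M" "n \<in> N" for m n
      using that by (auto simp: mem)
    have "left_ideal ?J R"
    proof (intro left_ideal.intro left_ideal_axioms.intro)
      show "additive_subgroup ?J R"
        using M.additive_subgroup_axioms N.additive_subgroup_axioms
        by (rule add_additive_subgroups)
      show "ring R" by (rule ring_axioms)
      fix a x assume "a \<in> ?J" and x: "x \<in> carrier R"
      then obtain m n where mn: "m \<in> M" "n \<in> N" and a: "a = m \<oplus> n"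
        by (auto simp: mem)
      have "x \<otimes> a = x \<otimes> m \<oplus> x \<otimes> n"
        using mn x a by (simp add: r_distr)
      then show "x \<otimes> a \<in> ?J"
        using mn x by (simp add: memI M.l_closed N.I_l_closed)
    qed
    moreover have "M \<subseteq> ?J"
    proof
      fix m assume "m \<in> M"
      then show "m \<in> ?J" using memI[of m \<zero>] by simp
    qed
    moreover have NJ: "N \<subseteq> ?J"
    proof
      fix n assume "n \<in> N"
      then show "n \<in> ?J" using memI[of \<zero> n] by simp
    qed
    moreover have "?J \<subseteq> carrier R"
      by (auto simp: mem)
    ultimately have "?J = carrier R"
      using M.I_maximal \<open>\<not> N \<subseteq> M\<close> by metis
    then obtain m n where mn: "m \<in> M" "n \<in> N" and one: "\<one> = m \<oplus> n"
      using mem[of \<one>] by auto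
    have "n = n \<otimes> (m \<oplus> n)"
      using mn one[symmetric] by simp
    also have "\<dots> = n \<otimes> m"
      using mn sq by (simp add: r_distr)
    finally have nm: "n = n \<otimes> m" .
    have "n \<otimes> m \<in> M"
      using M.l_closed[OF mn(1), of n] mn(2) by simp
    then have "n \<in> M"
      by (simp flip: nm)
    then have "\<one> \<in> M"
      using mn one by simp
    then have "x \<in> M" if "x \<in> carrier R" for x
      using M.l_closed[of \<one> x] that by simp
    then show False
      using M.I_notcarr M.a_subset by blast
  qed
  then show ?thesis
    by (auto simp: jacobson_radical_def)
qed

text \<open>Two annihilators replace an explicit description of \<open>Idl {e}\<close>. The left
  annihilator of the left ideal \<open>R e\<close> is two-sided and contains \<open>e\<close>, so
  \<open>z e = 0\<close> for all \<open>z\<close> in \<open>Idl {e}\<close>; then the right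
  annihilator of \<open>Idl {e}\<close> is two-sided and contains \<open>e\<close>.\<close>

lemma (in ring) genideal_square_zero:
  assumes e: "e \<in> carrier R"
    and ere: "\<And>r. r \<in> carrier R \<Longrightarrow> e \<otimes> r \<otimes> e = \<zero>"
    and x: "x \<in> Idl {e}" and y: "y \<in> Idl {e}"
  shows "x \<otimes> y = \<zero>"
proof -
  let ?N = "Idl {e}"
  interpret N: ideal ?N R
    using e by (intro genideal_ideal) simp
  have ideal_annI: "ideal {z \<in> carrier R. \<forall>a\<in>T. z \<otimes> a = \<zero>} R"
    if "T \<subseteq> carrier R" "\<And>r a. r \<in> carrier R \<Longrightarrow> a \<in> T \<Longrightarrow> r \<otimes> a \<in> T" for T
  proof (rule idealI[OF ring_axioms])
    show "subgroup {z \<in> carrier R. \<forall>a\<in>T. z \<otimes> a = \<zero>} (add_monoid R)"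
      using that(1) by (intro add.subgroupI) (auto simp: l_distr l_minus subset_iff)
  qed (use that in \<open>auto simp: m_assoc subset_iff\<close>)
  have ideal_annI': "ideal {z \<in> carrier R. \<forall>a\<in>T. a \<otimes> z = \<zero>} R"
    if "T \<subseteq> carrier R" "\<And>r a. r \<in> carrier R \<Longrightarrow> a \<in> T \<Longrightarrow> a \<otimes> r \<in> T" for T
  proof (rule idealI[OF ring_axioms])
    show "subgroup {z \<in> carrier R. \<forall>a\<in>T. a \<otimes> z = \<zero>} (add_monoid R)"
      using that(1) by (intro add.subgroupI) (auto simp: r_distr r_minus subset_iff)
  qed (use that in \<open>auto simp: m_assoc[symmetric] subset_iff\<close>)
  define T where "T = (\<lambda>r. r \<otimes> e) ` carrier R"
  have "?N \<subseteq> {z \<in> carrier R. \<forall>a\<in>T. z \<otimes> a = \<zero>}"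
  proof (rule genideal_minimal[OF ideal_annI])
    fix r a assume r: "r \<in> carrier R" and "a \<in> T"
    then obtain q where q: "q \<in> carrier R" "a = q \<otimes> e"
      by (auto simp: T_def)
    then have "r \<otimes> a = (r \<otimes> q) \<otimes> e"
      using r e by (simp add: m_assoc)
    then show "r \<otimes> a \<in> T"
      using r q by (simp add: T_def)
  next
    show "{e} \<subseteq> {z \<in> carrier R. \<forall>a\<in>T. z \<otimes> a = \<zero>}"
      using e ere by (simp add: T_def m_assoc)
  qed (use e in \<open>auto simp: T_def\<close>)
  moreover have "\<one> \<otimes> e \<in> T"
    unfolding T_def using one_closed by (rule imageI)
  then have "e \<in> T"
    using e by simp
  ultimately have Te: "z \<otimes> e = \<zero>" if "z \<in> ?N" for z
    using that by blast
  have "?N \<subseteq> {z \<in> carrier R. \<forall>a\<in>?N. a \<otimes> z = \<zero>}"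
  proof (rule genideal_minimal[OF ideal_annI'])
    show "{e} \<subseteq> {z \<in> carrier R. \<forall>a\<in>?N. a \<otimes> z = \<zero>}"
      using e Te by simp
  qed (use N.I_r_closed N.a_subset in simp_all)
  then show ?thesis
    using x y by blast
qed

section \<open>Free algebras and their modules\<close>

text \<open>Elements are sums of scalar multiples of words, and words grow from the empty one by
  prepending letters. Left multiplication by generators suits the left modules below.\<close>

lemma free_alg_induct [case_names const add gen]:
  fixes p :: "'x free_alg"
  assumes const: "\<And>c. P (Poly_Mapping.single 0 c)"
    and add: "\<And>p q. P p \<Longrightarrow> P q \<Longrightarrow> P (p + q)"
    and gen: "\<And>x p. P p \<Longrightarrow> P (gen x * p)"
  shows "P p"
proof -
  have single: "P (Poly_Mapping.single (Word xs) c)" for xs c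
  proof (induction xs)
    case Nil
    then show ?case using const[of c] by (simp add: zero_word_def)
  next
    case (Cons x xs)
    have "Poly_Mapping.single (Word (x # xs)) c = gen x * Poly_Mapping.single (Word xs) c"
      by (simp add: gen_def mult_single plus_word_def)
    then show ?case using gen[OF Cons] by simp
  qed
  show ?thesis
  proof (induction p rule: update_induct)
    case const
    then show ?case using assms(1)[of 0] by simp
  next
    case (update f a b)
    \<comment> \<open>\<open>a\<close> lies outside the support of \<open>f\<close>, so the update
      adds a monomial.\<close>
    have "Poly_Mapping.update a b f = f + Poly_Mapping.single a b"
      using update(1)
      by (intro poly_mapping_eqI)
        (auto simp: lookup_update lookup_add lookup_single when_def not_in_keys_iff_lookup_eq_zero)
    then show ?case using add[OF update(3) single[of "letters a" b]] by simp
  qed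
qed

lemma single_0_commute:
  fixes p :: "'x free_alg"
  shows "Poly_Mapping.single 0 c * p = p * Poly_Mapping.single 0 c"
proof (induction p rule: free_alg_induct)
  case (const d)
  then show ?case by (simp add: mult_single mult.commute)
next
  case (add p q)
  then show ?case by (simp add: algebra_simps)
next
  case (gen x p)
  have "Poly_Mapping.single 0 c * gen x = gen x * Poly_Mapping.single 0 c"
    by (simp add: gen_def mult_single)
  then show ?case by (metis gen mult.assoc)
qed

text \<open>The universal property of the free algebra: any choice of linear operators for the
  generators extends to a left module.\<close>

locale free_alg_module = vector_space scale
  for scale :: "complex \<Rightarrow> 'v::ab_group_add \<Rightarrow> 'v" (infixr "*s" 75) +
  fixes \<rho> :: "'x \<Rightarrow> 'v \<Rightarrow> 'v"
  assumes rho_add: "\<rho> x (u + v) = \<rho> x u + \<rho> x v"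
    and rho_scale: "\<rho> x (c *s v) = c *s \<rho> x v"
begin

text \<open>\<open>foldr\<close> lets the last letter of a word act first, so concatenation becomes
  composition.\<close>

definition act :: "'x free_alg \<Rightarrow> 'v \<Rightarrow> 'v" where
  "act p v = (\<Sum>w\<in>Poly_Mapping.keys p. Poly_Mapping.lookup p w *s foldr \<rho> (letters w) v)"

lemma act_single: "act (Poly_Mapping.single w c) v = c *s foldr \<rho> (letters w) v"
  by (simp add: act_def)

lemma act_const [simp]: "act (Poly_Mapping.single 0 c) v = c *s v"
  by (simp add: act_single zero_word_def)

lemma act_one [simp]: "act 1 v = v"
  using act_const[of 1 v] by simp

lemma act_zero [simp]: "act 0 v = 0"
  by (simp add: act_def)

lemma act_gen [simp]: "act (gen x) v = \<rho> x v"
  by (simp add: gen_def act_single)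

lemma act_add [simp]: "act (p + q) v = act p v + act q v"
  unfolding act_def by (rule setsum_keys_plus_distrib) (simp_all add: scale_left_distrib)

lemma act_minus [simp]: "act (- p) v = - act p v"
  using act_add[of p "- p" v] by (simp add: eq_neg_iff_add_eq_0 add.commute)

lemma act_diff [simp]: "act (p - q) v = act p v - act q v"
  using act_add[of p "- q" v] by simp

lemma act_gen_mult: "act (gen x * p) v = \<rho> x (act p v)"
proof -
  have rho_zero: "\<rho> x 0 = 0"
    using rho_scale[of x 0 0] by simp
  have rho_sum: "\<rho> x (\<Sum>i\<in>A. f i) = (\<Sum>i\<in>A. \<rho> x (f i))" for A :: "'x word set" and f
    by (induction A rule: infinite_finite_induct) (simp_all add: rho_zero rho_add)
  have "p = (\<Sum>w\<in>Poly_Mapping.keys p. Poly_Mapping.single w (Poly_Mapping.lookup p w))"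
    by (intro poly_mapping_eqI)
      (auto simp: lookup_sum lookup_single when_def not_in_keys_iff_lookup_eq_zero sum.delta)
  then have "gen x * p = (\<Sum>w\<in>Poly_Mapping.keys p.
      Poly_Mapping.single (Word [x] + w) (Poly_Mapping.lookup p w))"
    by (metis (no_types, lifting) gen_def mult_1 mult_single sum.cong sum_distrib_left)
  moreover have "act (sum f A) v = (\<Sum>i\<in>A. act (f i) v)" for A :: "'x word set" and f
    by (induction A rule: infinite_finite_induct) simp_all
  ultimately have "act (gen x * p) v = (\<Sum>w\<in>Poly_Mapping.keys p.
      Poly_Mapping.lookup p w *s \<rho> x (foldr \<rho> (letters w) v))"
    by (simp add: act_single plus_word_def)
  also have "\<dots> = \<rho> x (act p v)"
    by (simp add: act_def rho_sum rho_scale)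
  finally show ?thesis .
qed

lemma act_mult [simp]: "act (p * q) v = act p (act q v)"
proof (induction p rule: free_alg_induct)
  case (const c)
  show ?case
  proof (induction q rule: free_alg_induct)
    case (const d)
    then show ?case by (simp add: mult_single)
  next
    case (add p q)
    then show ?case by (simp add: distrib_left scale_right_distrib)
  next
    case (gen x p)
    have "act (Poly_Mapping.single 0 c * (gen x * p)) v
        = act (gen x * (Poly_Mapping.single 0 c * p)) v"
      by (metis mult.assoc single_0_commute)
    then show ?case using gen by (simp add: act_gen_mult rho_scale)
  qed
next
  case (add p q)
  then show ?case by (simp add: distrib_right)
next
  case (gen x p)
  then show ?case by (simp add: mult.assoc act_gen_mult)
qed

lemma act_zero_right [simp]: "act p 0 = 0"
  \<comment> \<open>\<open>undefined\<close> is an arbitrary vector, which \<open>act 0\<close>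
    sends to 0.\<close>
  using act_mult[of p 0 undefined] by simp

end

section \<open>Ideals and left ideals of $V_2$\<close>

lemma v2_free_simps [simp]:
  "x \<otimes>\<^bsub>v2_free\<^esub> y = x * y" "x \<oplus>\<^bsub>v2_free\<^esub> y = x + y"
  "\<one>\<^bsub>v2_free\<^esub> = 1" "\<zero>\<^bsub>v2_free\<^esub> = 0"
  by (simp_all add: v2_free_def ring_of_type_algebra_def)

lemma a_inv_v2_free [simp]: "\<ominus>\<^bsub>v2_free\<^esub> p = - p"
proof -
  interpret ring v2_free by (rule ring_v2_free)
  show ?thesis by (rule minus_equality) simp_all
qed

lemma ideal_v2_freeI:
  assumes "0 \<in> I" "\<And>p q. p \<in> I \<Longrightarrow> q \<in> I \<Longrightarrow> p + q \<in> I"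
    and l: "\<And>p r. p \<in> I \<Longrightarrow> r * p \<in> I" and "\<And>p r. p \<in> I \<Longrightarrow> p * r \<in> I"
  shows "ideal I v2_free"
proof -
  interpret ring v2_free by (rule ring_v2_free)
  have "- p \<in> I" if "p \<in> I" for p
    using l[OF that, of "- 1"] by simp
  then show ?thesis
    using assms by (intro idealI[OF ring_v2_free] add.subgroupI) (auto simp flip: a_inv_def)
qed

lemma
  assumes "ideal I v2_free"
  shows v2_free_ideal_zero: "0 \<in> I"
    and v2_free_ideal_add: "\<And>p q. p \<in> I \<Longrightarrow> q \<in> I \<Longrightarrow> p + q \<in> I"
    and v2_free_ideal_mult_left: "\<And>p r. p \<in> I \<Longrightarrow> r * p \<in> I"
    and v2_free_ideal_mult_right: "\<And>p r. p \<in> I \<Longrightarrow> p * r \<in> I"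
    and v2_free_ideal_minus: "\<And>p. p \<in> I \<Longrightarrow> - p \<in> I"
    and v2_free_ideal_diff: "\<And>p q. p \<in> I \<Longrightarrow> q \<in> I \<Longrightarrow> p - q \<in> I"
proof -
  interpret ideal I v2_free by fact
  show "0 \<in> I" using additive_subgroup.zero_closed[OF ideal.axioms(1)[OF assms]] by (simp only: v2_free_simps)
  show add: "p + q \<in> I" if "p \<in> I" "q \<in> I" for p q
    using additive_subgroup.a_closed[OF ideal.axioms(1)[OF assms] that] by simp
  show "r * p \<in> I" "p * r \<in> I" if "p \<in> I" for p r
    using I_l_closed[OF that, of r] I_r_closed[OF that, of r] by simp_all
  show minus: "- p \<in> I" if "p \<in> I" for p
    using additive_subgroup.a_inv_closed[OF ideal.axioms(1)[OF assms] that] by simp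
  show "p - q \<in> I" if "p \<in> I" "q \<in> I" for p q
    using add[OF that(1) minus[OF that(2)]] by simp
qed

lemmas v2_ideal_closed =
  v2_free_ideal_zero[OF ideal_v2_ideal] v2_free_ideal_add[OF ideal_v2_ideal]
  v2_free_ideal_mult_left[OF ideal_v2_ideal] v2_free_ideal_mult_right[OF ideal_v2_ideal]
  v2_free_ideal_minus[OF ideal_v2_ideal] v2_free_ideal_diff[OF ideal_v2_ideal]

lemma v2_class_simps:
  "v2_class p \<otimes>\<^bsub>V2\<^esub> v2_class q = v2_class (p * q)"
  "v2_class p \<oplus>\<^bsub>V2\<^esub> v2_class q = v2_class (p + q)"
  "\<one>\<^bsub>V2\<^esub> = v2_class 1"
  using ring_hom_mult[OF v2_class_hom, of p q] ring_hom_add[OF v2_class_hom, of p q]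
    ring_hom_one[OF v2_class_hom] by simp_all

lemma ring_hom_ring_v2_class: "ring_hom_ring v2_free V2 v2_class"
  using ring_v2_free ring_V2 v2_class_hom by (rule ring_hom_ringI2)

lemma v2_class_zero: "\<zero>\<^bsub>V2\<^esub> = v2_class 0"
  using ring_hom_zero[OF v2_class_hom ring_v2_free ring_V2] by simp

lemma v2_class_uminus: "\<ominus>\<^bsub>V2\<^esub> v2_class p = v2_class (- p)"
proof -
  interpret ring_hom_ring v2_free V2 v2_class by (rule ring_hom_ring_v2_class)
  show ?thesis using hom_a_inv[of p] by simp
qed

lemma v2_class_eq_iff: "v2_class p = v2_class q \<longleftrightarrow> p - q \<in> v2_ideal"
proof -
  interpret ideal v2_ideal v2_free by (rule ideal_v2_ideal)
  show ?thesis
    using quotient_eq_iff_same_a_r_cos[OF ideal_v2_ideal, of p q]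
    by (auto simp: v2_class_def a_minus_def)
qed

lemma carrier_V2: "carrier V2 = range v2_class"
  by (auto simp: V2_def FactRing_def A_RCOSETS_def' v2_class_def)

lemma left_ideal_v2_class_image:
  assumes "0 \<in> L" "\<And>p q. p \<in> L \<Longrightarrow> q \<in> L \<Longrightarrow> p + q \<in> L" and l: "\<And>p r. p \<in> L \<Longrightarrow> r * p \<in> L"
  shows "left_ideal (v2_class ` L) V2"
proof -
  interpret ring V2 by (rule ring_V2)
  have "- p \<in> L" if "p \<in> L" for p
    using l[OF that, of "- 1"] by simp
  then have "subgroup (v2_class ` L) (add_monoid V2)"
    using assms
    by (intro add.subgroupI) (auto simp: v2_class_simps v2_class_uminus simp flip: a_inv_def)
  then show ?thesis
    using l by (intro left_ideal.intro left_ideal_axioms.intro additive_subgroup.intro ring_V2)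
      (auto simp: carrier_V2 v2_class_simps)
qed

text \<open>\<open>irred\<close> says that \<open>v\<close> lies in every nonzero submodule. A left
  ideal strictly above the annihilator of \<open>v\<close> contains some \<open>q\<close> with
  \<open>q v \<noteq> 0\<close>; if \<open>r q v = v\<close>, every \<open>p\<close> is the sum of
  \<open>p - p r q\<close>, which kills \<open>v\<close>, and a left multiple of
  \<open>q\<close>.\<close>

lemma maximal_left_ideal_of_irreducible:
  assumes "free_alg_module scale \<rho>"
  defines "act \<equiv> free_alg_module.act scale \<rho>"
  assumes kill: "\<And>p u. p \<in> v2_ideal \<Longrightarrow> act p u = 0"
    and irred: "\<And>w. w \<noteq> 0 \<Longrightarrow> \<exists>r. act r w = v" and "v \<noteq> 0"
  shows "maximal_left_ideal (v2_class ` {p. act p v = 0}) V2"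
proof -
  interpret A: free_alg_module scale \<rho> by fact
  note [simp] = A.act_one[folded act_def] A.act_zero[folded act_def]
    A.act_zero_right[folded act_def] A.act_add[folded act_def] A.act_diff[folded act_def]
    A.act_mult[folded act_def]
  let ?L = "{p. act p v = 0}"
  interpret L: left_ideal "v2_class ` ?L" V2
    by (rule left_ideal_v2_class_image) simp_all
  \<comment> \<open>Elements of \<open>v2_ideal\<close> kill \<open>v\<close>, so \<open>?L\<close>
    is a union of cosets.\<close>
  have mem: "v2_class p \<in> v2_class ` ?L \<longleftrightarrow> p \<in> ?L" for p
  proof
    assume "v2_class p \<in> v2_class ` ?L"
    then obtain q where "p - q \<in> v2_ideal" "act q v = 0"
      by (auto simp: v2_class_eq_iff)
    then show "p \<in> ?L" using kill[of "p - q" v] by simp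
  qed simp
  show ?thesis
  proof unfold_locales
    have "v2_class 1 \<notin> v2_class ` ?L"
      unfolding mem using \<open>v \<noteq> 0\<close> by simp
    then show "carrier V2 \<noteq> v2_class ` ?L"
      by (metis v2_class_in_carrier)
  next
    fix J assume "left_ideal J V2" and sub: "v2_class ` ?L \<subseteq> J" and carr: "J \<subseteq> carrier V2"
    interpret J: left_ideal J V2 by fact
    show "J = v2_class ` ?L \<or> J = carrier V2"
    proof (cases "J \<subseteq> v2_class ` ?L")
      case False
      then obtain x where x: "x \<in> J" "x \<notin> v2_class ` ?L"
        by blast
      then obtain q where "x = v2_class q"
        using carr by (auto simp: carrier_V2)
      then have q: "v2_class q \<in> J" "act q v \<noteq> 0"
        using x by auto
      then obtain r where r: "act r (act q v) = v" using irred by blast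
      have "v2_class p \<in> J" for p
      proof -
        have "p - p * (r * q) \<in> ?L"
          using r by simp
        then have "v2_class (p - p * (r * q)) \<in> J"
          using sub by blast
        moreover have "v2_class (p * (r * q)) \<in> J"
          using J.l_closed[OF q(1), of "v2_class (p * r)"] by (simp add: v2_class_simps mult.assoc)
        ultimately have "v2_class (p - p * (r * q)) \<oplus>\<^bsub>V2\<^esub> v2_class (p * (r * q)) \<in> J"
          by (rule J.a_closed)
        then show ?thesis by (simp add: v2_class_simps)
      qed
      then show ?thesis using carr by (auto simp: carrier_V2)
    qed (use sub in auto)
  qed
qed

text \<open>Stated for arbitrary \<open>I\<close> so as to serve both \<open>v2_ideal\<close> and
  larger ideals containing \<open>gen E1\<close>.\<close>

lemma v2_relations:
  assumes "v2_relators \<subseteq> I"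
  shows "gen S1 * gen S1 - 1 \<in> I" "gen E1 * gen E1 \<in> I" "gen E1 * gen S1 - gen E1 \<in> I"
    "gen S1 * gen E1 + gen E1 \<in> I" "gen Y1 * gen Y2 - gen Y2 * gen Y1 \<in> I"
    "gen S1 * gen Y1 - gen Y2 * gen S1 + gen E1 + 1 \<in> I"
    "gen Y1 * gen S1 - gen S1 * gen Y2 - gen E1 + 1 \<in> I"
    "gen E1 * (gen Y1 - gen Y2) + gen E1 \<in> I" "(gen Y1 - gen Y2) * gen E1 - gen E1 \<in> I"
  using assms by (simp_all add: v2_relators_def Let_def algebra_simps)

lemma v2_relators_subset_ideal: "v2_relators \<subseteq> v2_ideal"
  unfolding v2_ideal_def by (rule ring.genideal_self[OF ring_v2_free]) simp

lemma v2_ideal_subset: "v2_ideal \<subseteq> Idl\<^bsub>v2_free\<^esub> (insert (gen E1) v2_relators)"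
proof -
  interpret ring v2_free by (rule ring_v2_free)
  have "insert (gen E1) v2_relators \<subseteq> Idl\<^bsub>v2_free\<^esub> (insert (gen E1) v2_relators)"
    by (rule genideal_self) simp
  then show ?thesis
    unfolding v2_ideal_def by (intro genideal_minimal genideal_ideal) simp_all
qed

section \<open>The ideal generated by $e_1$ squares to zero\<close>

text \<open>
  The elements \<open>t\<close> with \<open>t s\<^sub>1 = t\<close> and \<open>t (y\<^sub>1 - y\<^sub>2) = - t\<close> form a right ideal, which
  contains \<open>e\<^sub>1\<close>, and are killed by right multiplication with \<open>e\<^sub>1\<close>, because
  \<open>t e\<^sub>1 = t s\<^sub>1 e\<^sub>1 = - t e\<^sub>1\<close>.
\<close>

lemma E1_mult_E1_in_v2_ideal: "gen E1 * p * gen E1 \<in> v2_ideal"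
proof -
  let ?s = "gen S1" and ?e = "gen E1" and ?y = "gen Y1" and ?z = "gen Y2"
  note rel = v2_relations[OF v2_relators_subset_ideal]
  note add = v2_ideal_closed(2) and lm = v2_ideal_closed(3) and rm = v2_ideal_closed(4)
    and neg = v2_ideal_closed(5) and diff = v2_ideal_closed(6)
  define P where "P t \<longleftrightarrow> t * ?s - t \<in> v2_ideal \<and> t * (?y - ?z) + t \<in> v2_ideal" for t
  have te: "t * ?e \<in> v2_ideal" if "P t" for t
  proof -
    \<comment> \<open>That \<open>t * ?e\<close> is congruent to its negative only shows that its
      double vanishes; the scalar 1/2 removes the factor 2.\<close>
    let ?h = "Poly_Mapping.single 0 (1 / 2) :: v2_gen free_alg"
    have half: "?h + ?h = 1"
      by (simp flip: single_add)
    have "t * ?e = (?h + ?h) * (t * ?e)"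
      by (simp add: half)
    also have "\<dots> = ?h * (t * (?s * ?e + ?e) - (t * ?s - t) * ?e)"
      by (simp add: algebra_simps)
    also have "\<dots> \<in> v2_ideal"
      using that unfolding P_def by (intro lm[OF diff[OF lm[OF rel(4)] rm]]) simp
    finally show ?thesis .
  qed
  have P_cong: "P u" if "P t" "t - u \<in> v2_ideal" for t u
  proof -
    have t: "t * ?s - t \<in> v2_ideal" "t * (?y - ?z) + t \<in> v2_ideal"
      using that(1) by (simp_all add: P_def)
    have "u * ?s - u = t * ?s - t - (t - u) * ?s + (t - u)"
      "u * (?y - ?z) + u = t * (?y - ?z) + t - (t - u) * (?y - ?z) - (t - u)"
      by (simp_all add: algebra_simps)
    moreover have "t * ?s - t - (t - u) * ?s + (t - u) \<in> v2_ideal"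
      "t * (?y - ?z) + t - (t - u) * (?y - ?z) - (t - u) \<in> v2_ideal"
      using that(2) add[OF diff[OF t(1) rm] that(2)] diff[OF diff[OF t(2) rm] that(2)] by simp_all
    ultimately show ?thesis by (simp add: P_def)
  qed
  have P_add: "P (t + u)" if "P t" "P u" for t u
  proof -
    have "(t + u) * ?s - (t + u) = (t * ?s - t) + (u * ?s - u)"
      "(t + u) * (?y - ?z) + (t + u) = (t * (?y - ?z) + t) + (u * (?y - ?z) + u)"
      by (simp_all add: algebra_simps)
    then show ?thesis using that add unfolding P_def by metis
  qed
  have P_const: "P (t * Poly_Mapping.single 0 c)" if "P t" for t c
  proof -
    let ?c = "Poly_Mapping.single 0 c :: v2_gen free_alg"
    have "?c * t * ?s - ?c * t = ?c * (t * ?s - t)"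
      "?c * t * (?y - ?z) + ?c * t = ?c * (t * (?y - ?z) + t)"
      by (simp_all add: algebra_simps)
    then have "P (?c * t)" using that lm unfolding P_def by metis
    then show ?thesis by (simp add: single_0_commute)
  qed
  have P_z: "P (t * ?z)" if t: "P t" for t
  proof -
    have t1: "t * ?s - t \<in> v2_ideal" and t2: "t * (?y - ?z) + t \<in> v2_ideal"
      using t by (simp_all add: P_def)
    \<comment> \<open>Modulo the ideal, \<open>t z s = t s y + t e + t = t y + t = t z\<close>, and
      \<open>t z (y - z) = t (y - z) z = - t z\<close> because \<open>y\<close> and \<open>z\<close>
      commute.\<close>
    have "t * ?z * ?s - t * ?z =
        (t * ?s - t) * ?y + (t * (?y - ?z) + t) + t * ?e - t * (?s * ?y - ?z * ?s + ?e + 1)"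
      "t * ?z * (?y - ?z) + t * ?z =
        (t * (?y - ?z) + t) * ?z - t * (?y * ?z - ?z * ?y)"
      by (simp_all add: algebra_simps)
    moreover have "(t * ?s - t) * ?y + (t * (?y - ?z) + t) + t * ?e
        - t * (?s * ?y - ?z * ?s + ?e + 1) \<in> v2_ideal"
      "(t * (?y - ?z) + t) * ?z - t * (?y * ?z - ?z * ?y) \<in> v2_ideal"
      using diff[OF add[OF add[OF rm[OF t1] t2] te[OF t]] lm[OF rel(6)]]
        diff[OF rm[OF t2] lm[OF rel(5)]] .
    ultimately show ?thesis by (simp add: P_def)
  qed
  \<comment> \<open>Modulo the ideal, \<open>t s = t\<close>, \<open>t e = 0\<close> and
    \<open>t y = t z - t\<close>, which reduces everything to right multiplication by
    \<open>?z\<close>.\<close>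
  have P_gen: "P (t * gen x)" if t: "P t" for t x
  proof (cases x)
    case S1
    have "t - t * ?s \<in> v2_ideal"
      using neg[of "t * ?s - t"] t by (simp add: P_def)
    then show ?thesis using P_cong[OF t] S1 by simp
  next
    case E1
    have "P 0" by (simp add: P_def v2_ideal_closed(1))
    then show ?thesis using P_cong[of 0 "t * ?e"] neg[OF te[OF t]] E1 by simp
  next
    case Y1
    have "P (t * ?z + t * Poly_Mapping.single 0 (- 1))"
      by (rule P_add[OF P_z[OF t] P_const[OF t]])
    moreover have "Poly_Mapping.single 0 (- 1) = (- 1 :: v2_gen free_alg)"
      by (simp add: single_uminus)
    ultimately have "P (t * ?z - t)" by simp
    moreover have "t * ?z - t - t * ?y \<in> v2_ideal"
      using neg[of "t * (?y - ?z) + t"] t by (simp add: P_def algebra_simps)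
    ultimately show ?thesis using P_cong Y1 by blast
  next
    case Y2
    then show ?thesis using P_z[OF t] by simp
  qed
  have "P (t * p)" if "P t" for t
    using that
  proof (induction p arbitrary: t rule: free_alg_induct)
    case (const c)
    then show ?case by (rule P_const)
  next
    case (add p q)
    then show ?case using P_add by (simp add: distrib_left)
  next
    case (gen x p)
    then show ?case using P_gen by (metis mult.assoc)
  qed
  moreover have "P ?e"
    using rel(3,8) by (simp add: P_def)
  ultimately show ?thesis by (intro te)
qed

lemma genideal_v2_e1_subset_jacobson_radical: "Idl\<^bsub>V2\<^esub> {v2_e1} \<subseteq> jacobson_radical V2"
proof -
  interpret ring V2 by (rule ring_V2)
  have e: "v2_e1 \<in> carrier V2"
    by (simp add: v2_e1_def)
  have ere: "v2_e1 \<otimes>\<^bsub>V2\<^esub> r \<otimes>\<^bsub>V2\<^esub> v2_e1 = \<zero>\<^bsub>V2\<^esub>" if "r \<in> carrier V2" for r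
  proof -
    from that obtain p where "r = v2_class p"
      by (auto simp: carrier_V2)
    then show ?thesis
      using E1_mult_E1_in_v2_ideal[of p]
      by (simp add: v2_e1_def v2_class_simps v2_class_zero v2_class_eq_iff)
  qed
  show ?thesis
  proof (rule square_zero_ideal_subset_jacobson_radical)
    show "ideal (Idl\<^bsub>V2\<^esub> {v2_e1}) V2"
      by (rule genideal_ideal) (simp add: e)
  qed (rule genideal_square_zero[OF e ere])
qed

section \<open>A spanning set modulo $e_1$\<close>

definition eval_Y1 :: "complex poly \<Rightarrow> v2_gen free_alg" where
  "eval_Y1 p = fold_coeffs (\<lambda>c q. Poly_Mapping.single 0 c + gen Y1 * q) p 0"

text \<open>The coefficients of \<open>f\<close> are polynomials in \<open>y\<^sub>1\<close>; the outer variable is \<open>y\<^sub>2\<close>.\<close>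

definition eval_Y :: "complex poly poly \<Rightarrow> v2_gen free_alg" where
  "eval_Y f = fold_coeffs (\<lambda>p q. eval_Y1 p + gen Y2 * q) f 0"

lemma eval_Y1_0 [simp]: "eval_Y1 0 = 0"
  by (simp add: eval_Y1_def)

lemma eval_Y1_pCons [simp]: "eval_Y1 (pCons c p) = Poly_Mapping.single 0 c + gen Y1 * eval_Y1 p"
  by (cases "c = 0 \<and> p = 0") (auto simp: eval_Y1_def)

lemma eval_Y_0 [simp]: "eval_Y 0 = 0"
  by (simp add: eval_Y_def)

lemma eval_Y_pCons [simp]: "eval_Y (pCons p f) = eval_Y1 p + gen Y2 * eval_Y f"
  by (cases "p = 0 \<and> f = 0") (auto simp: eval_Y_def)

lemma eval_Y1_add: "eval_Y1 (p + q) = eval_Y1 p + eval_Y1 q"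
  by (induction p q rule: poly_induct2) (simp_all add: single_add algebra_simps)

lemma eval_Y_add: "eval_Y (f + g) = eval_Y f + eval_Y g"
  by (induction f g rule: poly_induct2) (simp_all add: eval_Y1_add algebra_simps)

lemma eval_Y_diff: "eval_Y (f - g) = eval_Y f - eval_Y g"
  using eval_Y_add[of "f - g" g] by simp

text \<open>\<open>eval_Y\<close> puts the powers of \<open>gen Y2\<close> to the left of those of
  \<open>gen Y1\<close>. Left multiplication by \<open>gen Y2\<close> is therefore just
  \<open>pCons 0\<close>, while \<open>gen Y1\<close> must be commuted past each
  \<open>gen Y2\<close> to reach the coefficients.\<close>

lemma eval_Y_smult_X:
  assumes K: "ideal K v2_free" and rel: "gen Y1 * gen Y2 - gen Y2 * gen Y1 \<in> K"
  shows "gen Y1 * eval_Y f - eval_Y (smult [:0, 1:] f) \<in> K"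
proof (induction f)
  case 0
  then show ?case using v2_free_ideal_zero[OF K] by simp
next
  case (pCons p f)
  have "gen Y1 * eval_Y (pCons p f) - eval_Y (smult [:0, 1:] (pCons p f)) =
      (gen Y1 * gen Y2 - gen Y2 * gen Y1) * eval_Y f
      + gen Y2 * (gen Y1 * eval_Y f - eval_Y (smult [:0, 1:] f))"
    by (simp add: algebra_simps)
  then show ?case
    using pCons.IH rel v2_free_ideal_add[OF K] v2_free_ideal_mult_left[OF K]
      v2_free_ideal_mult_right[OF K] by metis
qed

text \<open>The spanning half of the Poincare-Birkhoff-Witt theorem for the degenerate affine Hecke
  algebra: modulo \<open>K\<close>, the normal forms contain the scalars and are stable under sums
  and under left multiplication by each generator.\<close>

lemma eval_Y_span:
  assumes K: "ideal K v2_free" and rels: "v2_relators \<subseteq> K" and e: "gen E1 \<in> K"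
  shows "\<exists>f g. p - (eval_Y f + gen S1 * eval_Y g) \<in> K"
proof (induction p rule: free_alg_induct)
  case (const c)
  have "Poly_Mapping.single 0 c - (eval_Y [:[:c:]:] + gen S1 * eval_Y 0) \<in> K"
    using v2_free_ideal_zero[OF K] by simp
  then show ?case by blast
next
  case (add p q)
  then obtain f g f' g' where "p - (eval_Y f + gen S1 * eval_Y g) \<in> K"
    "q - (eval_Y f' + gen S1 * eval_Y g') \<in> K"
    by blast
  from v2_free_ideal_add[OF K this]
  have "p + q - (eval_Y (f + f') + gen S1 * eval_Y (g + g')) \<in> K"
    by (simp add: eval_Y_add algebra_simps)
  then show ?case by blast
next
  case (gen x p)
  let ?s = "gen S1" and ?e = "gen E1" and ?y = "gen Y1" and ?z = "gen Y2"
  note rel = v2_relations[OF rels]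
  note add = v2_free_ideal_add[OF K] and lm = v2_free_ideal_mult_left[OF K]
    and rm = v2_free_ideal_mult_right[OF K] and diff = v2_free_ideal_diff[OF K]
  note X = eval_Y_smult_X[OF K rel(5)]
  from gen obtain f g where k: "p - (eval_Y f + ?s * eval_Y g) \<in> K" (is "?k \<in> K")
    by blast
  show ?case
  proof (cases x)
    case S1
    have "?s * p - (eval_Y g + ?s * eval_Y f) = ?s * ?k + (?s * ?s - 1) * eval_Y g"
      by (simp add: algebra_simps)
    also have "\<dots> \<in> K" by (rule add[OF lm[OF k] rm[OF rel(1)]])
    finally show ?thesis using S1 by blast
  next
    case E1
    have "?e * p - (eval_Y 0 + ?s * eval_Y 0) \<in> K"
      using rm[OF e] by simp
    then show ?thesis using E1 by blast
  next
    case Y1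
    \<comment> \<open>Modulo \<open>K\<close>, \<open>y1 s1 = s1 y2 - 1\<close>; hence the terms
      \<open>- g\<close> and \<open>pCons 0 g\<close>.\<close>
    have "?y * p - (eval_Y (smult [:0, 1:] f - g) + ?s * eval_Y (pCons 0 g)) =
        ?y * ?k + (?y * eval_Y f - eval_Y (smult [:0, 1:] f))
        + (?y * ?s - ?s * ?z - ?e + 1) * eval_Y g + ?e * eval_Y g"
      by (simp add: eval_Y_diff algebra_simps)
    also have "\<dots> \<in> K" by (rule add[OF add[OF add[OF lm[OF k] X] rm[OF rel(7)]] rm[OF e]])
    finally show ?thesis using Y1 by blast
  next
    case Y2
    \<comment> \<open>Modulo \<open>K\<close>, \<open>y2 s1 = s1 y1 + 1\<close>; hence the terms
      \<open>+ g\<close> and \<open>smult [:0, 1:] g\<close>.\<close>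
    have "?z * p - (eval_Y (pCons 0 f + g) + ?s * eval_Y (smult [:0, 1:] g)) =
        ?z * ?k + ?s * (?y * eval_Y g - eval_Y (smult [:0, 1:] g))
        + ?e * eval_Y g - (?s * ?y - ?z * ?s + ?e + 1) * eval_Y g"
      by (simp add: eval_Y_add algebra_simps)
    also have "\<dots> \<in> K" by (rule diff[OF add[OF add[OF lm[OF k] lm[OF X]] rm[OF e]] rm[OF rel(6)]])
    finally show ?thesis using Y2 by blast
  qed
qed

section \<open>The principal series modules\<close>

definition scale2 :: "complex \<Rightarrow> complex \<times> complex \<Rightarrow> complex \<times> complex" where
  "scale2 c v = (c * fst v, c * snd v)"

lemma scale2_Pair [simp]: "scale2 c (x, y) = (c * x, c * y)"
  by (simp add: scale2_def)

text \<open>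
  The basis consists of simultaneous eigenvectors of \<open>y\<^sub>1\<close> and \<open>y\<^sub>2\<close>; the relations then force
  the diagonal of the matrix of \<open>s\<^sub>1\<close> and the product of its other two entries.
\<close>

fun principal_action :: "complex \<Rightarrow> complex \<Rightarrow> v2_gen \<Rightarrow> complex \<times> complex \<Rightarrow> complex \<times> complex" where
  "principal_action a b S1 v =
    (snd v - fst v / (a - b), (1 - 1 / (a - b)\<^sup>2) * fst v + snd v / (a - b))"
| "principal_action a b E1 v = 0"
| "principal_action a b Y1 v = (a * fst v, b * snd v)"
| "principal_action a b Y2 v = (b * fst v, a * snd v)"

text \<open>\<open>neq\<close> makes the divisions in \<open>principal_action\<close> genuine and
  separates the eigenvalues of \<open>Y1\<close>; the other two conditions make the off-diagonal
  entry \<open>1 - 1/(a - b)^2\<close> of \<open>S1\<close> nonzero.\<close>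

locale principal_series =
  fixes a b :: complex
  assumes neq: "a \<noteq> b" and neq_plus: "a \<noteq> b + 1" and neq_minus: "a \<noteq> b - 1"
begin

lemma free_alg_module: "free_alg_module scale2 (principal_action a b)"
proof
  fix x c and u v :: "complex \<times> complex"
  show "principal_action a b x (u + v) = principal_action a b x u + principal_action a b x v"
    by (cases x) (simp_all add: prod_eq_iff algebra_simps add_divide_distrib)
  show "principal_action a b x (scale2 c v) = scale2 c (principal_action a b x v)"
    by (cases x) (simp_all add: prod_eq_iff scale2_def algebra_simps)
qed (simp_all add: scale2_def prod_eq_iff algebra_simps)

sublocale free_alg_module scale2 "principal_action a b"
  by (rule free_alg_module)

lemma act_relators:
  assumes "p \<in> insert (gen E1) v2_relators"
  shows "act p v = 0"
proof -
  define d where "d = a - b"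
  then have d: "d \<noteq> 0" "a = b + d" "a - b = d" using neq by auto
  \<comment> \<open>The two coordinates of each of \<open>s1 s1 = 1\<close>,
    \<open>s1 y1 - y2 s1 = -1\<close> and \<open>y1 s1 - s1 y2 = -1\<close>, the relations in which
    \<open>S1\<close> survives once \<open>E1\<close> acts by zero.\<close>
  have identities:
    "(1 - 1 / d\<^sup>2) * x + y / d - (y - x / d) / d = x"
    "(1 - 1 / d\<^sup>2) * (y - x / d) + ((1 - 1 / d\<^sup>2) * x + y / d) / d = y"
    "b * y - a * x / d - b * (y - x / d) + x = 0"
    "(1 - 1 / d\<^sup>2) * (a * x) + b * y / d - a * ((1 - 1 / d\<^sup>2) * x + y / d) + y = 0"
    "a * (y - x / d) - (a * y - b * x / d) + x = 0"
    "b * ((1 - 1 / d\<^sup>2) * x + y / d) - ((1 - 1 / d\<^sup>2) * (b * x) + a * y / d) + y = 0"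
    for x y
    using d(1)
    by (simp_all add: d(2) diff_divide_distrib add_divide_distrib algebra_simps power2_eq_square)
  have "p = gen E1 \<or> p \<in> v2_relators"
    using assms by simp
  then show ?thesis
    unfolding v2_relators_def Let_def insert_iff empty_iff
    by (elim disjE) (simp_all add: prod_eq_iff d(3) identities)
qed

text \<open>The common annihilator of all vectors is a two-sided ideal, so checking the generators
  suffices.\<close>

lemma act_ideal:
  assumes "p \<in> Idl\<^bsub>v2_free\<^esub> (insert (gen E1) v2_relators)"
  shows "act p v = 0"
proof -
  have "ideal {p. \<forall>v. act p v = 0} v2_free"
    by (rule ideal_v2_freeI) (simp_all del: split_paired_All)
  then have "Idl\<^bsub>v2_free\<^esub> (insert (gen E1) v2_relators) \<subseteq> {p. \<forall>v. act p v = 0}"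
    using act_relators by (intro ring.genideal_minimal[OF ring_v2_free]) auto
  then show ?thesis using assms by blast
qed

text \<open>\<open>y1 - b\<close> kills the second basis vector and multiplies the first by
  \<open>a - b\<close>, so after rescaling it sends a vector with nonzero first coordinate to
  \<open>(1, 0)\<close>. If the first coordinate is zero, \<open>s1\<close> moves the second one
  there.\<close>

lemma irreducible:
  assumes "w \<noteq> 0"
  shows "\<exists>r. act r w = (1, 0)"
proof -
  have *: "\<exists>r. act r u = (1, 0)" if "fst u \<noteq> 0" for u
  proof
    let ?c = "Poly_Mapping.single 0 :: complex \<Rightarrow> v2_gen free_alg"
    show "act (?c (1 / ((a - b) * fst u)) * (gen Y1 - ?c b)) u = (1, 0)"
      using that neq by (simp add: scale2_def prod_eq_iff flip: left_diff_distrib)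
  qed
  show ?thesis
  proof (cases "fst w = 0")
    case True
    then have "fst (act (gen S1) w) \<noteq> 0"
      using assms by (simp add: prod_eq_iff)
    then obtain r where "act (r * gen S1) w = (1, 0)"
      using * by fastforce
    then show ?thesis by blast
  qed (use * in auto)
qed

lemma maximal: "maximal_left_ideal (v2_class ` {p. act p (1, 0) = 0}) V2"
proof (rule maximal_left_ideal_of_irreducible[OF free_alg_module _ irreducible])
  fix p u assume "p \<in> v2_ideal"
  then show "act p u = 0"
    using v2_ideal_subset act_ideal by blast
qed (simp_all add: zero_prod_def)

lemma act_eval_Y1: "act (eval_Y1 p) (1, 0) = (poly p a, 0)"
  by (induction p) (simp_all add: zero_prod_def)

lemma act_eval_Y: "act (eval_Y f) (1, 0) = (poly (poly f [:b:]) a, 0)"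
  by (induction f) (simp_all add: act_eval_Y1 zero_prod_def)

text \<open>As \<open>(1, 0)\<close> is a joint eigenvector, the vector is
  \<open>f(a, b) (1, 0) + g(a, b) s1 (1, 0)\<close>. Its second coordinate sees only
  \<open>g\<close>, with the nonzero factor \<open>1 - 1/(a - b)^2\<close>.\<close>

lemma act_span_eq_0:
  assumes "act (eval_Y f + gen S1 * eval_Y g) (1, 0) = 0"
  shows "poly (poly f [:b:]) a = 0" "poly (poly g [:b:]) a = 0"
proof -
  have "(a - b)\<^sup>2 \<noteq> 1"
    using neq_plus neq_minus by (auto simp: power2_eq_1_iff algebra_simps)
  then have "1 - 1 / (a - b)\<^sup>2 \<noteq> 0"
    using neq by (simp add: field_simps)
  moreover have "(1 - 1 / (a - b)\<^sup>2) * poly (poly g [:b:]) a = 0"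
    using arg_cong[OF assms, of snd] by (simp add: act_eval_Y)
  ultimately show "poly (poly g [:b:]) a = 0"
    using mult_eq_0_iff by blast
  then show "poly (poly f [:b:]) a = 0"
    using arg_cong[OF assms, of fst] by (simp add: act_eval_Y)
qed

end

section \<open>Polynomials vanishing at generic points, and the conclusion\<close>

lemma poly_poly_eq_0_of_generic:
  fixes f :: "complex poly poly"
  assumes "\<And>a b. principal_series a b \<Longrightarrow> poly (poly f [:b:]) a = 0"
  shows "f = 0"
proof -
  \<comment> \<open>For fixed \<open>b\<close> only three values of \<open>a\<close> escape the
    hypothesis, too few for a nonzero polynomial in \<open>a\<close>.\<close>
  have "poly f [:b:] = 0" for b
  proof (rule ccontr)
    assume "poly f [:b:] \<noteq> 0"
    then have "finite ({a. poly (poly f [:b:]) a = 0} \<union> {b, b + 1, b - 1})"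
      using poly_roots_finite by auto
    moreover have "{a. poly (poly f [:b:]) a = 0} \<union> {b, b + 1, b - 1} = UNIV"
      using assms by (auto simp: principal_series_def)
    ultimately show False
      using infinite_UNIV_char_0 by metis
  qed
  \<comment> \<open>Every constant is now a root of \<open>f\<close>, viewed as a polynomial over
    the integral domain of complex polynomials.\<close>
  then have "range (\<lambda>b. [:b:]) \<subseteq> {p. poly f p = 0}"
    by auto
  moreover have "infinite (range (\<lambda>b :: complex. [:b:]))"
    by (subst finite_image_iff) (auto simp: infinite_UNIV_char_0 intro: injI)
  ultimately show ?thesis
    using poly_roots_finite infinite_super by blast
qed

theorem lemma17:
  shows "jacobson_radical V2 = Idl\<^bsub>V2\<^esub> {v2_e1}"
proof
  let ?K = "Idl\<^bsub>v2_free\<^esub> (insert (gen E1) v2_relators)"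
  let ?E = "Idl\<^bsub>V2\<^esub> {v2_e1}"
  have K: "ideal ?K v2_free"
    by (rule ring.genideal_ideal[OF ring_v2_free]) simp
  have gens: "insert (gen E1) v2_relators \<subseteq> ?K"
    by (rule ring.genideal_self[OF ring_v2_free]) simp
  have E: "ideal ?E V2"
    by (rule ring.genideal_ideal[OF ring_V2]) (simp add: v2_e1_def)
  have E_self: "v2_e1 \<in> ?E"
    by (rule ring.genideal_self'[OF ring_V2]) (simp add: v2_e1_def)
  \<comment> \<open>This places \<open>?K\<close> in the preimage of \<open>?E\<close>: the relators
    have class zero, and \<open>gen E1\<close> has class \<open>v2_e1\<close>.\<close>
  have "v2_class p \<in> ?E" if "p \<in> insert (gen E1) v2_relators" for p
  proof (cases "p = gen E1")
    case False
    then have "v2_class p = \<zero>\<^bsub>V2\<^esub>"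
      using that v2_relators_subset_ideal by (auto simp: v2_class_zero v2_class_eq_iff)
    then show ?thesis
      using additive_subgroup.zero_closed[OF ideal.axioms(1)[OF E]] by simp
  qed (use E_self in \<open>simp add: v2_e1_def\<close>)
  moreover have "ideal {p. v2_class p \<in> ?E} v2_free"
    using ring_hom_ring.ideal_vimage[OF ring_hom_ring_v2_class E] by simp
  ultimately have K_E: "?K \<subseteq> {p. v2_class p \<in> ?E}"
    by (intro ring.genideal_minimal[OF ring_v2_free]) auto
  show "jacobson_radical V2 \<subseteq> ?E"
  proof
    fix x assume x: "x \<in> jacobson_radical V2"
    then obtain p where p: "x = v2_class p"
      by (auto simp: jacobson_radical_def carrier_V2)
    obtain f g where fg: "p - (eval_Y f + gen S1 * eval_Y g) \<in> ?K"
      using eval_Y_span[OF K] gens by blast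
    \<comment> \<open>The annihilator of \<open>(1, 0)\<close> gives a maximal left ideal containing
      \<open>x\<close>, so \<open>p\<close> kills \<open>(1, 0)\<close>; so does its normal form,
      because \<open>?K\<close> acts by zero.\<close>
    have "poly (poly f [:b:]) a = 0 \<and> poly (poly g [:b:]) a = 0" if "principal_series a b" for a b
    proof -
      interpret principal_series a b by fact
      have "v2_class p \<in> v2_class ` {p. act p (1, 0) = 0}"
        using x p maximal by (auto simp: jacobson_radical_def)
      then obtain q where q: "p - q \<in> v2_ideal" "act q (1, 0) = 0"
        by (auto simp: v2_class_eq_iff)
      have "act (p - q) (1, 0) = 0"
        using q(1) v2_ideal_subset act_ideal by blast
      then have "act p (1, 0) = 0"
        using q(2) by simp
      moreover have "act p (1, 0) = act (eval_Y f + gen S1 * eval_Y g) (1, 0)"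
        using act_ideal[OF fg, of "(1, 0)"] by (simp only: act_diff right_minus_eq)
      ultimately have "act (eval_Y f + gen S1 * eval_Y g) (1, 0) = 0"
        by (simp only:)
      then show ?thesis using act_span_eq_0 by blast
    qed
    then have "f = 0" "g = 0"
      by (auto intro: poly_poly_eq_0_of_generic)
    \<comment> \<open>With \<open>f\<close> and \<open>g\<close> zero, \<open>fg\<close> says that
      \<open>p\<close> itself lies in \<open>?K\<close>.\<close>
    then show "x \<in> ?E"
      using fg K_E p by auto
  qed
qed (rule genideal_v2_e1_subset_jacobson_radical)

end
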